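(* Assume that there are constants $C\ge 1$, $\mathcal{Q}\ge 1$ and non-negative numbers $q_{i,k}$ ($1\le k\le i$) such that $\sum_{k=1}^i k(i-k+1)q_{i,k}\le \mathcal{Q}\,i$ for all $i\in\mathbb{N}_+$, and $a(i,j;k)\le C(i-k+1)(j+k)q_{i,k}$ for all integers $1\le k\le i$ and all $j\in\mathbb{N}_+$. Let $c^{\mathrm{in}}=(c^{\mathrm{in}}_i)_{i\ge 0}\in X_{0,1}^+$ and let $c=(c_i)_{i\ge0}$ be an admissible solution of the initial value problem for the DGED system in the non-isolated case with initial condition $c(0)=c^{\mathrm{in}}$. Then, for all $t\ge 0$, $$\sum_{i=0}^\infty i\,c_i(t)=\sum_{i=0}^\infty i\,c^{\mathrm{in}}_i .$$
   Context: Notation: $\mathbb{N}=\{0,1,2,\dots\}$, $\mathbb{N}_+=\mathbb{N}\setminus\{0\}$. Rate coefficients: real numbers $a(p,q;k)\ge 0$ are given for all integers $p\ge1$, $q\ge 0$, $1\le k\le p$. Standing assumptions: $a(p,0;p)=0$ for all $p\in\mathbb{N}_+$; $a(k,j;k)=a(j,k;j)$ for all $j,k\in\mathbb{N}_+$; $a(i,0;k)=a(i,0;i-k)$ for all $i\in\mathbb{N}_+$, $1\le k\le i-1$. Discrete generalized exchange-driven (DGED) system, non-isolated case: $\dot c_i=\sum_{j=1}^4 Q_{j,i}(c)$, $i\in\mathbb{N}$, where for $i\in\mathbb{N}_+$ $$Q_{1,i}(c)=\sum_{k=1}^\infty\sum_{j=0}^\infty a(i+k,j;k)c_{i+k}c_j,\qquad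 Q_{2,i}(c)=-\sum_{k=1}^\infty\sum_{j=k}^\infty a(j,i;k)c_jc_i,$$ $$Q_{3,i}(c)=\sum_{k=1}^i\sum_{j=k}^\infty a(j,i-k;k)c_jc_{i-k},\qquad Q_{4,i}(c)=-\sum_{k=1}^i\sum_{j=0}^\infty a(i,j;k)c_jc_i,$$ and $Q_{j,0}=0$ for $j=1,2,3,4$ (so $\dot c_0=0$). Spaces: $X_{0,1}=\{c:\mathbb{N}\to\mathbb{R} : \|c\|:=\sum_{i=0}^\infty(1+i)|c_i|<\infty\}$, $X_{0,1}^+=\{c\in X_{0,1}: c_i\ge 0\ \forall i\}$. Mild solution: for $T\in(0,+\infty]$, a (mild) solution on $[0,T)$ with initial condition $c^{\mathrm{in}}\in X_{0,1}^+$ is a sequence of nonnegative functions $c=(c_i):[0,T)\to X_{0,1}^+$ such that for each $i\in\mathbb{N}$ and $t\in(0,T)$: (i) $c_i\in C^0([0,T))$; (ii) $Q_{j,i}(c(\cdot))\in L^1(0,t)$ for $j=1,2,3,4$; (iii) $c_i(t)=c^{\mathrm{in}}_i+\int_0^t\sum_{j=1}^4Q_{j,i}(c(s))\,ds$. Truncated system ($N$-DGED), non-isolated case: for $N\ge 1$, the ODE system in $\mathbb{R}^{N+1}$ given by $\dot c_0=0$ and $\dot c_i=\sum_{j=1}^4Q^N_{j,i}(c)$, $1\le i\le N$, where (empty sums being zero) $$Q^N_{1,i}(c)=\sum_{k=1}^{N-i}\sum_{j=0}^{N-k}a(i+k,j;k)c_{i+k}c_j,\qquad Q^N_{2,i}(c)=-\sum_{k=1}^{N-i}\sum_{j=k}^{N}a(j,i;k)c_jc_i,$$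 $$Q^N_{3,i}(c)=\sum_{k=1}^{i}\sum_{j=k}^{N}a(j,i-k;k)c_jc_{i-k},\qquad Q^N_{4,i}(c)=-\sum_{k=1}^{i}\sum_{j=0}^{N-k}a(i,j;k)c_jc_i .$$ Denote by $c^N=(c^N_i)_{0\le i\le N}$ its (unique, nonnegative, global) solution with $c^N_i(0)=c^{\mathrm{in}}_i$, $0\le i\le N$. Admissible solution: a mild solution $c$ on $[0,\infty)$ with initial condition $c^{\mathrm{in}}$ which is obtained as a limit of solutions of the truncated systems, i.e. there is a strictly increasing sequence of integers $N$ along which $c^N_i(t)\to c_i(t)$ as $N\to\infty$ for every $i\in\mathbb{N}$ and every $t\in[0,\infty)$. *)

theory Defs
  imports "HOL-Analysis.Analysis"
begin

text \<open>
  The coefficient \<open>a(p,q;k)\<close> is \<open>a p q k\<close> for a total function \<open>a\<close>; only its values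
  for \<open>1 \<le> k \<le> p\<close> are constrained, and only these occur in the equations below.
\<close>

type_synonym rates = "nat \<Rightarrow> nat \<Rightarrow> nat \<Rightarrow> real"

definition rate_coefficients :: "rates \<Rightarrow> bool" where
  "rate_coefficients a \<longleftrightarrow>
     (\<forall>p q k. 1 \<le> k \<and> k \<le> p \<longrightarrow> 0 \<le> a p q k) \<and>
     (\<forall>p\<ge>1. a p 0 p = 0) \<and>
     (\<forall>j\<ge>1. \<forall>k\<ge>1. a k j k = a j k j) \<and>
     (\<forall>i\<ge>1. \<forall>k. 1 \<le> k \<and> k \<le> i - 1 \<longrightarrow> a i 0 k = a i 0 (i - k))"

definition X01 :: "(nat \<Rightarrow> real) set" where
  "X01 = {c. summable (\<lambda>i. (1 + real i) * \<bar>c i\<bar>)}"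

definition X01_pos :: "(nat \<Rightarrow> real) set" where
  "X01_pos = {c \<in> X01. \<forall>i. 0 \<le> c i}"

text \<open>
  The case \<open>i = 0\<close> is set to zero: this is the non-isolated system.
\<close>

definition Q1 :: "rates \<Rightarrow> (nat \<Rightarrow> real) \<Rightarrow> nat \<Rightarrow> real" where
  "Q1 a c i = (if i = 0 then 0 else
     (\<Sum>\<^sub>\<infinity>k\<in>{1..}. \<Sum>\<^sub>\<infinity>j\<in>{0..}. a (i + k) j k * c (i + k) * c j))"

definition Q2 :: "rates \<Rightarrow> (nat \<Rightarrow> real) \<Rightarrow> nat \<Rightarrow> real" where
  "Q2 a c i = (if i = 0 then 0 else
     - (\<Sum>\<^sub>\<infinity>k\<in>{1..}. \<Sum>\<^sub>\<infinity>j\<in>{k..}. a j i k * c j * c i))"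

definition Q3 :: "rates \<Rightarrow> (nat \<Rightarrow> real) \<Rightarrow> nat \<Rightarrow> real" where
  "Q3 a c i = (if i = 0 then 0 else
     (\<Sum>k=1..i. \<Sum>\<^sub>\<infinity>j\<in>{k..}. a j (i - k) k * c j * c (i - k)))"

definition Q4 :: "rates \<Rightarrow> (nat \<Rightarrow> real) \<Rightarrow> nat \<Rightarrow> real" where
  "Q4 a c i = (if i = 0 then 0 else
     - (\<Sum>k=1..i. \<Sum>\<^sub>\<infinity>j\<in>{0..}. a i j k * c j * c i))"

text \<open>
  A divergent \<^const>\<open>infsum\<close> has the value 0, so convergence of the iterated series defining
  the \<open>Q\<^sub>j\<^sub>,\<^sub>i\<close> has to be required separately.
\<close>

definition iterated_summable ::
    "(nat \<Rightarrow> nat \<Rightarrow> real) \<Rightarrow> nat set \<Rightarrow> (nat \<Rightarrow> nat set) \<Rightarrow> bool" where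
  "iterated_summable f A B \<longleftrightarrow>
     (\<forall>k\<in>A. f k summable_on B k) \<and> (\<lambda>k. \<Sum>\<^sub>\<infinity>j\<in>B k. f k j) summable_on A"

definition Q_converge :: "rates \<Rightarrow> (nat \<Rightarrow> real) \<Rightarrow> nat \<Rightarrow> bool" where
  "Q_converge a c i \<longleftrightarrow> (i \<ge> 1 \<longrightarrow>
     iterated_summable (\<lambda>k j. a (i + k) j k * c (i + k) * c j) {1..} (\<lambda>k. {0..}) \<and>
     iterated_summable (\<lambda>k j. a j i k * c j * c i) {1..} (\<lambda>k. {k..}) \<and>
     iterated_summable (\<lambda>k j. a j (i - k) k * c j * c (i - k)) {1..i} (\<lambda>k. {k..}) \<and>
     iterated_summable (\<lambda>k j. a i j k * c j * c i) {1..i} (\<lambda>k. {0..}))"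

text \<open>
  \<open>Q\<^sub>j\<^sub>,\<^sub>i(c(\<cdot>)) \<in> L\<^sup>1(0,t)\<close> is read as: the series converges at almost every time in
  \<open>(0,t)\<close> and the resulting function is Lebesgue integrable there.
\<close>

definition mild_solution ::
    "rates \<Rightarrow> ereal \<Rightarrow> (nat \<Rightarrow> real) \<Rightarrow> (real \<Rightarrow> nat \<Rightarrow> real) \<Rightarrow> bool" where
  "mild_solution a T cin c \<longleftrightarrow>
     (\<forall>t. 0 \<le> t \<and> ereal t < T \<longrightarrow> c t \<in> X01_pos) \<and>
     (\<forall>i. continuous_on {t. 0 \<le> t \<and> ereal t < T} (\<lambda>t. c t i)) \<and>
     (\<forall>i t. 0 < t \<and> ereal t < T \<longrightarrow>
        (AE s in lebesgue. s \<in> {0<..<t} \<longrightarrow> Q_converge a (c s) i) \<and>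
        (\<lambda>s. Q1 a (c s) i) absolutely_integrable_on {0<..<t} \<and>
        (\<lambda>s. Q2 a (c s) i) absolutely_integrable_on {0<..<t} \<and>
        (\<lambda>s. Q3 a (c s) i) absolutely_integrable_on {0<..<t} \<and>
        (\<lambda>s. Q4 a (c s) i) absolutely_integrable_on {0<..<t} \<and>
        c t i = cin i + (LINT s:{0<..<t}|lebesgue.
          Q1 a (c s) i + Q2 a (c s) i + Q3 a (c s) i + Q4 a (c s) i))"

text \<open>
  The truncated right-hand side. A vector of \<open>\<real>\<^bsup>N+1\<^esup>\<close> is a function of which only the
  entries \<open>0, \<dots>, N\<close> are used.
\<close>

definition QN1 :: "rates \<Rightarrow> nat \<Rightarrow> (nat \<Rightarrow> real) \<Rightarrow> nat \<Rightarrow> real" where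
  "QN1 a N c i = (\<Sum>k=1..N - i. \<Sum>j=0..N - k. a (i + k) j k * c (i + k) * c j)"

definition QN2 :: "rates \<Rightarrow> nat \<Rightarrow> (nat \<Rightarrow> real) \<Rightarrow> nat \<Rightarrow> real" where
  "QN2 a N c i = - (\<Sum>k=1..N - i. \<Sum>j=k..N. a j i k * c j * c i)"

definition QN3 :: "rates \<Rightarrow> nat \<Rightarrow> (nat \<Rightarrow> real) \<Rightarrow> nat \<Rightarrow> real" where
  "QN3 a N c i = (\<Sum>k=1..i. \<Sum>j=k..N. a j (i - k) k * c j * c (i - k))"

definition QN4 :: "rates \<Rightarrow> nat \<Rightarrow> (nat \<Rightarrow> real) \<Rightarrow> nat \<Rightarrow> real" where
  "QN4 a N c i = - (\<Sum>k=1..i. \<Sum>j=0..N - k. a i j k * c j * c i)"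

text \<open>
  The right-hand side is polynomial, hence locally Lipschitz, so the entries \<open>u t i\<close> with
  \<open>i \<le> N\<close> and \<open>t \<ge> 0\<close> are determined by the following.
\<close>

definition truncated_solution ::
    "rates \<Rightarrow> nat \<Rightarrow> (nat \<Rightarrow> real) \<Rightarrow> (real \<Rightarrow> nat \<Rightarrow> real) \<Rightarrow> bool" where
  "truncated_solution a N cin u \<longleftrightarrow>
     (\<forall>i\<le>N. u 0 i = cin i) \<and>
     (\<forall>t\<ge>0. ((\<lambda>s. u s 0) has_real_derivative 0) (at t within {0..})) \<and>
     (\<forall>t\<ge>0. \<forall>i\<in>{1..N}. ((\<lambda>s. u s i) has_real_derivative
        QN1 a N (u t) i + QN2 a N (u t) i + QN3 a N (u t) i + QN4 a N (u t) i)
          (at t within {0..}))"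

definition admissible_solution ::
    "rates \<Rightarrow> (nat \<Rightarrow> real) \<Rightarrow> (real \<Rightarrow> nat \<Rightarrow> real) \<Rightarrow> bool" where
  "admissible_solution a cin c \<longleftrightarrow>
     mild_solution a \<infinity> cin c \<and>
     (\<exists>N u. strict_mono N \<and>
        (\<forall>n::nat. N n \<ge> 1 \<and> truncated_solution a (N n) cin (u n)) \<and>
        (\<forall>i. \<forall>t\<ge>0. (\<lambda>n. u n t i) \<longlonglongrightarrow> c t i))"

end

theory Submission
  imports Defs
begin

text \<open>
  Fix \<open>m > 0\<close> and test the truncated systems against \<open>h x = x\<^sup>2 / (x + m)\<close>. This function is
  superadditive, so exchanges with the void do not increase \<open>\<Sum>i. h i * c i\<close>, and
  \<open>(x + y) (h (x + y) - h x - h y) \<le> 2 (y h x + x h y)\<close>, so under the growth condition on the rates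
  Gronwall's inequality yields \<open>(\<Sum>i. h i * c i t) \<le> exp (K t) (\<Sum>i. h i * c i 0)\<close> with \<open>K\<close>
  independent of \<open>m\<close> and of the truncation. Since \<open>h x \<ge> x / 2\<close> for \<open>x \<ge> m\<close>, and the
  right-hand side vanishes as \<open>m\<close> tends to infinity by dominated convergence, the tails of the first
  moment are small uniformly in the truncation, and the conservation of mass of the truncated systems
  passes to the limit.
\<close>

section \<open>The test functions\<close>

definition test_fun :: "real \<Rightarrow> real \<Rightarrow> real" where
  "test_fun m x = x\<^sup>2 / (x + m)"

lemma test_fun_0 [simp]: "test_fun m 0 = 0"
  by (simp add: test_fun_def)

lemma test_fun_nonneg: "m > 0 \<Longrightarrow> x \<ge> 0 \<Longrightarrow> 0 \<le> test_fun m x"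
  by (simp add: test_fun_def)

lemma test_fun_le:
  assumes "m > 0" "x \<ge> 0"
  shows "test_fun m x \<le> x"
  using assms by (simp add: test_fun_def divide_le_eq power2_eq_square algebra_simps)

lemma test_fun_ge_half:
  assumes "m > 0" "x \<ge> m"
  shows "x / 2 \<le> test_fun m x"
  using assms mult_left_mono[of m x x] by (simp add: test_fun_def field_simps power2_eq_square)

text \<open>For \<open>x, y >= 0\<close> every factor on the right is nonnegative, so both the sign
  and the size of the defect can be read off from this common fraction.\<close>

lemma test_fun_defect:
  assumes "m > 0" "x \<ge> 0" "y \<ge> 0"
  shows "test_fun m (x + y) - test_fun m x - test_fun m y =
           m * x * y * (x + y + 2 * m) / ((x + m) * (y + m) * (x + y + m))"
proof -
  have "x + m \<noteq> 0" "y + m \<noteq> 0" "x + y + m \<noteq> 0"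
    using assms by auto
  then show ?thesis
    unfolding test_fun_def by (simp add: divide_simps) algebra
qed

lemma test_fun_superadditive:
  assumes "m > 0" "x \<ge> 0" "y \<ge> 0"
  shows "test_fun m x + test_fun m y \<le> test_fun m (x + y)"
proof -
  have "0 \<le> m * x * y * (x + y + 2 * m) / ((x + m) * (y + m) * (x + y + m))"
    using assms by simp
  then show ?thesis
    using test_fun_defect[OF assms] by linarith
qed

text \<open>Once \<open>x * y / ((x + m) * (y + m))\<close> is factored out, the right side leaves
  \<open>2 * (2 * x * y + m * (x + y))\<close> and the left side at most
  \<open>2 * m * (x + y)\<close>. The weight \<open>x + y\<close> is there to absorb the factor
  \<open>j + k\<close> of the growth condition.\<close>

lemma test_fun_defect_le:
  assumes "m > 0" "x \<ge> 0" "y \<ge> 0"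
  shows "(x + y) * (test_fun m (x + y) - test_fun m x - test_fun m y)
           \<le> 2 * (y * test_fun m x + x * test_fun m y)"
proof -
  have pos: "x + m > 0" "y + m > 0" "x + y + m > 0"
    using assms by auto
  have "(x + y + 2 * m) / (x + y + m) \<le> 2"
    using assms pos by (simp add: divide_simps)
  then have "m * (x + y) * ((x + y + 2 * m) / (x + y + m)) \<le> m * (x + y) * 2"
    using assms by (intro mult_left_mono) auto
  also have "\<dots> \<le> 2 * (2 * x * y + m * (x + y))"
    using assms by (simp add: algebra_simps)
  finally have "x * y / ((x + m) * (y + m)) * (m * (x + y) * ((x + y + 2 * m) / (x + y + m)))
      \<le> x * y / ((x + m) * (y + m)) * (2 * (2 * x * y + m * (x + y)))"
    using assms by (intro mult_left_mono) auto
  moreover have "x * y / ((x + m) * (y + m)) * (2 * (2 * x * y + m * (x + y))) =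
      2 * (y * test_fun m x + x * test_fun m y)"
    using pos unfolding test_fun_def by (simp add: divide_simps) algebra
  moreover have "x * y / ((x + m) * (y + m)) * (m * (x + y) * ((x + y + 2 * m) / (x + y + m))) =
      (x + y) * (test_fun m (x + y) - test_fun m x - test_fun m y)"
    unfolding test_fun_defect[OF assms] by (simp add: mult_ac)
  ultimately show ?thesis
    by simp
qed

text \<open>The quotient \<open>test_fun m x / x = x / (x + m)\<close> is nondecreasing; the
  cross-multiplied form also covers the argument 0. It lets the \<open>k\<close> units moved be
  charged to the donor of size \<open>i >= k\<close>.\<close>

lemma test_fun_star_shaped:
  assumes "m > 0" "0 \<le> y" "y \<le> x"
  shows "x * test_fun m y \<le> y * test_fun m x"
proof -
  have "y / (y + m) \<le> x / (x + m)"
  proof (rule frac_le_eq[THEN iffD2])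
    show "y + m \<noteq> 0" "x + m \<noteq> 0"
      using assms by auto
    show "(y * (x + m) - x * (y + m)) / ((y + m) * (x + m)) \<le> 0"
      using assms by (intro divide_nonpos_pos mult_pos_pos) (auto simp: algebra_simps)
  qed
  then have "x * y * (y / (y + m)) \<le> x * y * (x / (x + m))"
    using assms by (intro mult_left_mono) auto
  then show ?thesis
    by (simp add: test_fun_def power2_eq_square mult_ac)
qed

text \<open>Each term tends to 0 as the parameter grows, and \<open>real i * b i\<close> is a
  summable majorant independent of the parameter, so Tannery's theorem exchanges limit and
  sum.\<close>

lemma test_fun_sum_tendsto_0:
  fixes b :: "nat \<Rightarrow> real"
  assumes "summable (\<lambda>i. real i * b i)" "\<And>i. 0 \<le> b i"
  shows "(\<lambda>m. \<Sum>i. test_fun (real (Suc m)) (real i) * b i) \<longlonglongrightarrow> 0"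
proof -
  have "(\<lambda>m. \<Sum>i. test_fun (real (Suc m)) (real i) * b i) \<longlonglongrightarrow> (\<Sum>i. 0)"
  proof (rule tannerys_theorem[THEN conjunct2, THEN conjunct2])
    show "((\<lambda>m. test_fun (real (Suc m)) (real i) * b i) \<longlonglongrightarrow> 0)" for i
    proof -
      have "filterlim (\<lambda>m. real i + real (Suc m)) at_top sequentially"
        by (intro filterlim_tendsto_add_at_top[OF tendsto_const]
            filterlim_compose[OF filterlim_real_sequentially filterlim_Suc])
      then have "(\<lambda>m. (real i)\<^sup>2 / (real i + real (Suc m))) \<longlonglongrightarrow> 0"
        by (intro tendsto_divide_0[OF tendsto_const] filterlim_at_top_imp_at_infinity)
      from tendsto_mult_left_zero[OF this] show ?thesis
        by (simp add: test_fun_def)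
    qed
    show "eventually (\<lambda>(i, m). norm (test_fun (real (Suc m)) (real i) * b i) \<le> real i * b i)
        (at_top \<times>\<^sub>F sequentially)"
      using assms(2)
      by (intro always_eventually)
        (auto simp: abs_mult intro!: mult_right_mono test_fun_le simp: test_fun_nonneg)
  qed (use assms in auto)
  then show ?thesis
    by simp
qed

section \<open>Differential inequalities\<close>

text \<open>The function \<open>exp (- K * t) * f t\<close> has a nonpositive derivative on the open
  interval and is continuous up to the end points.\<close>

lemma gronwall:
  fixes f f' :: "real \<Rightarrow> real"
  assumes deriv: "\<And>t. 0 \<le> t \<Longrightarrow> t \<le> T \<Longrightarrow> (f has_real_derivative f' t) (at t within {0..})"
    and le: "\<And>t. 0 \<le> t \<Longrightarrow> t \<le> T \<Longrightarrow> f' t \<le> K * f t"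
    and "0 \<le> T"
  shows "f T \<le> exp (K * T) * f 0"
proof (cases "T = 0")
  case False
  define \<phi> where "\<phi> t = exp (- K * t) * f t" for t
  have d: "(\<phi> has_real_derivative exp (- K * t) * (f' t - K * f t)) (at t within {0..})"
    if "0 \<le> t" "t \<le> T" for t
    unfolding \<phi>_def
    by (rule derivative_eq_intros deriv that refl | simp add: algebra_simps that)+
  have "\<phi> T \<le> \<phi> 0"
  proof (rule DERIV_nonpos_imp_decreasing_open[where f = \<phi>])
    show "\<exists>y. (\<phi> has_real_derivative y) (at t) \<and> y \<le> 0" if "0 < t" "t < T" for t
    proof -
      have "(\<phi> has_real_derivative exp (- K * t) * (f' t - K * f t)) (at t)"
        using d[of t] that at_within_interior[of t "{0..}"] by simp
      moreover have "exp (- K * t) * (f' t - K * f t) \<le> 0"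
        using le[of t] that by (simp add: mult_le_0_iff)
      ultimately show ?thesis
        by blast
    qed
    show "continuous_on {0..T} \<phi>"
    proof (rule DERIV_continuous_on)
      show "(\<phi> has_real_derivative exp (- K * t) * (f' t - K * f t)) (at t within {0..T})"
        if "t \<in> {0..T}" for t
        using d[of t] that by (auto intro: DERIV_subset)
    qed
  qed (use \<open>0 \<le> T\<close> in auto)
  then have "exp (K * T) * (exp (- K * T) * f T) \<le> exp (K * T) * f 0"
    by (simp add: \<phi>_def)
  then show ?thesis
    by (simp add: mult.assoc[symmetric] flip: exp_add)
qed simp

text \<open>Squaring removes the kink of the negative part at 0: the difference quotient there is
  bounded by \<open>\<bar>h\<bar>\<close>. Elsewhere the function is locally \<open>x^2\<close> or
  0, and the chain rule does the rest.\<close>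

lemma has_real_derivative_square_neg_part:
  fixes f :: "real \<Rightarrow> real"
  assumes "(f has_real_derivative D) (at t within S)"
  shows "((\<lambda>s. (max 0 (- f s))\<^sup>2) has_real_derivative (- 2 * max 0 (- f t) * D)) (at t within S)"
proof -
  have "((\<lambda>x::real. (max 0 (- x))\<^sup>2) has_real_derivative (- 2 * max 0 (- y))) (at y)" for y
  proof (cases y "0::real" rule: linorder_cases)
    case less
    have "((\<lambda>x::real. x\<^sup>2) has_real_derivative 2 * y) (at y)"
      by (auto intro!: derivative_eq_intros)
    then show ?thesis
      using less
      by (subst DERIV_cong_ev[OF refl _ refl, where g = "\<lambda>x. x\<^sup>2"])
        (auto intro: eventually_mono[OF order_tendstoD(2)[OF filterlim_ident less]])
  next
    case greater
    have "((\<lambda>x::real. 0) has_real_derivative 0) (at y)"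
      by simp
    then show ?thesis
      using greater
      by (subst DERIV_cong_ev[OF refl _ refl, where g = "\<lambda>x. 0"])
        (auto intro: eventually_mono[OF order_tendstoD(1)[OF filterlim_ident greater]])
  next
    case equal
    have "((\<lambda>h::real. (max 0 (- h))\<^sup>2 / h) \<longlongrightarrow> 0) (at 0)"
    proof (rule Lim_null_comparison)
      show "eventually (\<lambda>h::real. norm ((max 0 (- h))\<^sup>2 / h) \<le> \<bar>h\<bar>) (at 0)"
        by (intro always_eventually allI) (auto simp: max_def power2_eq_square)
      show "((\<lambda>h::real. \<bar>h\<bar>) \<longlongrightarrow> 0) (at 0)"
        by (rule tendsto_rabs_zero) (rule tendsto_ident_at)
    qed
    then show ?thesis
      using equal by (simp add: DERIV_def)
  qed
  from DERIV_chain2[OF this assms] show ?thesis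
    by simp
qed

lemma sum_mult_sum_le_card_sum_squares:
  fixes v :: "'a \<Rightarrow> real"
  assumes "finite S"
  shows "(\<Sum>i\<in>S. v i) * (\<Sum>j\<in>S. v j) \<le> real (card S) * (\<Sum>i\<in>S. (v i)\<^sup>2)"
  using sum_squared_le_sum_of_squares[of v S] assms by (simp add: power2_eq_square mult.commute)

text \<open>The sum \<open>F\<close> of the squared negative parts starts at 0 and satisfies
  \<open>F' <= 2 * K * card S * F\<close> by Cauchy-Schwarz, so Gronwall's inequality keeps it at
  0.\<close>

lemma quasi_positive_nonneg:
  fixes u d :: "real \<Rightarrow> 'i \<Rightarrow> real"
  assumes "finite S" "0 \<le> T"
    and init: "\<And>i. i \<in> S \<Longrightarrow> 0 \<le> u 0 i"
    and deriv: "\<And>t i. 0 \<le> t \<Longrightarrow> t \<le> T \<Longrightarrow> i \<in> S \<Longrightarrow>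
      ((\<lambda>s. u s i) has_real_derivative d t i) (at t within {0..})"
    and lower: "\<And>t i. 0 \<le> t \<Longrightarrow> t \<le> T \<Longrightarrow> i \<in> S \<Longrightarrow> u t i < 0 \<Longrightarrow>
      - K * (\<Sum>j\<in>S. max 0 (- u t j)) \<le> d t i"
    and "0 \<le> K" "i \<in> S"
  shows "0 \<le> u T i"
proof -
  define v where "v t j = max 0 (- u t j)" for t j
  define F where "F t = (\<Sum>j\<in>S. (v t j)\<^sup>2)" for t
  have "F T \<le> exp (2 * K * real (card S) * T) * F 0"
  proof (rule gronwall)
    fix t assume t: "0 \<le> t" "t \<le> T"
    show "(F has_real_derivative (\<Sum>j\<in>S. - 2 * v t j * d t j)) (at t within {0..})"
      unfolding F_def v_def
      by (intro DERIV_sum has_real_derivative_square_neg_part deriv t)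
    have "(\<Sum>j\<in>S. - 2 * v t j * d t j) \<le> (\<Sum>j\<in>S. 2 * v t j * (K * (\<Sum>j\<in>S. v t j)))"
    proof (rule sum_mono)
      fix j assume j: "j \<in> S"
      show "- 2 * v t j * d t j \<le> 2 * v t j * (K * (\<Sum>j\<in>S. v t j))"
      \<comment> \<open>A component that is not negative has \<open>v t j = 0\<close>, so both sides
        vanish; this is why \<open>lower\<close> is required at negative components only.\<close>
      proof (cases "u t j < 0")
        case True
        then have "2 * v t j * (- d t j) \<le> 2 * v t j * (K * (\<Sum>j\<in>S. v t j))"
          using lower[OF t j] by (intro mult_left_mono) (auto simp: v_def)
        then show ?thesis
          by (simp only: mult_minus_left mult_minus_right)
      qed (simp add: v_def)
    qed
    also have "\<dots> = 2 * K * ((\<Sum>j\<in>S. v t j) * (\<Sum>j\<in>S. v t j))"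
      by (simp add: sum_distrib_left sum_distrib_right mult_ac)
    also have "\<dots> \<le> 2 * K * (real (card S) * F t)"
      unfolding F_def using assms
      by (intro mult_left_mono sum_mult_sum_le_card_sum_squares) auto
    finally show "(\<Sum>j\<in>S. - 2 * v t j * d t j) \<le> 2 * K * real (card S) * F t"
      by (simp add: mult_ac)
  qed fact
  moreover have "F 0 = 0"
    using init by (simp add: F_def v_def)
  ultimately have "F T \<le> 0"
    by simp
  moreover have "(v T i)\<^sup>2 \<le> F T"
    unfolding F_def using assms by (intro member_le_sum) auto
  ultimately have "v T i = 0"
    by (metis order_trans power2_less_eq_zero_iff)
  then show ?thesis
    by (simp add: v_def max_def split: if_splits)
qed

section \<open>The truncated systems\<close>

text \<open>This is the right-hand side for \<open>i >= 1\<close> only: at \<open>i = 0\<close> the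
  four sums need not cancel, whereas the non-isolated system keeps the component 0 constant.\<close>

definition QN :: "rates \<Rightarrow> nat \<Rightarrow> (nat \<Rightarrow> real) \<Rightarrow> nat \<Rightarrow> real" where
  "QN a N c i = QN1 a N c i + QN2 a N c i + QN3 a N c i + QN4 a N c i"

text \<open>The triple \<open>(i, k, j)\<close> stands for the reaction of an \<open>i\<close>- and a \<open>j\<close>-cluster that moves \<open>k\<close> units.\<close>

definition events :: "nat \<Rightarrow> (nat \<times> nat \<times> nat) set" where
  "events N = (SIGMA i:{1..N}. SIGMA k:{1..i}. {0..N - k})"

text \<open>All four sums run over the same reactions. In \<open>QN1\<close> to \<open>QN4\<close>
  the index \<open>i\<close> is, respectively, the remainder of the donor, the recipient before, the
  recipient after, and the donor before the exchange.\<close>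

lemma QN_weak_form:
  assumes "g 0 = 0"
  shows "(\<Sum>i=1..N. g i * QN a N c i) =
    (\<Sum>(i, k, j)\<in>events N. a i j k * c i * c j * (g (i - k) - g i + g (j + k) - g j))"
proof -
  \<comment> \<open>A remainder \<open>i - k\<close> or a recipient \<open>j\<close> may be 0, so
    the reindexing of \<open>QN1\<close> and \<open>QN2\<close> needs the index 0, which
    \<open>g 0 = 0\<close> adds at no cost.\<close>
  have from_0: "(\<Sum>i=1..N. g i * f i) = (\<Sum>i\<in>{0..N}. g i * f i)" for f
    using assms by (intro sum.mono_neutral_left) (auto simp: Suc_le_eq)
  have "(\<Sum>i=1..N. g i * QN1 a N c i) =
      (\<Sum>(i, k, j)\<in>(SIGMA i:{0..N}. SIGMA k:{1..N - i}. {0..N - k}).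
        g i * (a (i + k) j k * c (i + k) * c j))"
    unfolding from_0 QN1_def by (simp add: sum_distrib_left sum.Sigma split_beta)
  also have "\<dots> = (\<Sum>(i, k, j)\<in>events N. a i j k * c i * c j * g (i - k))"
    unfolding events_def
    by (rule sum.reindex_bij_witness[of _ "\<lambda>(i, k, j). (i - k, k, j)" "\<lambda>(i, k, j). (i + k, k, j)"])
      auto
  finally have 1: "(\<Sum>i=1..N. g i * QN1 a N c i) = \<dots>" .
  have "(\<Sum>i=1..N. g i * QN2 a N c i) =
      (\<Sum>(i, k, j)\<in>(SIGMA i:{0..N}. SIGMA k:{1..N - i}. {k..N}). - (g i * (a j i k * c j * c i)))"
    unfolding from_0 QN2_def by (simp add: sum_distrib_left sum.Sigma split_beta sum_negf)
  also have "\<dots> = (\<Sum>(i, k, j)\<in>events N. - (a i j k * c i * c j * g j))"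
    unfolding events_def
    by (rule sum.reindex_bij_witness[of _ "\<lambda>(i, k, j). (j, k, i)" "\<lambda>(i, k, j). (j, k, i)"]) auto
  finally have 2: "(\<Sum>i=1..N. g i * QN2 a N c i) = \<dots>" .
  have "(\<Sum>i=1..N. g i * QN3 a N c i) =
      (\<Sum>(i, k, j)\<in>(SIGMA i:{1..N}. SIGMA k:{1..i}. {k..N}).
        g i * (a j (i - k) k * c j * c (i - k)))"
    unfolding QN3_def by (simp add: sum_distrib_left sum.Sigma split_beta)
  also have "\<dots> = (\<Sum>(i, k, j)\<in>events N. a i j k * c i * c j * g (j + k))"
    unfolding events_def
    by (rule sum.reindex_bij_witness[of _ "\<lambda>(i, k, j). (j + k, k, i)" "\<lambda>(i, k, j). (j, k, i - k)"])
      auto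
  finally have 3: "(\<Sum>i=1..N. g i * QN3 a N c i) = \<dots>" .
  have 4: "(\<Sum>i=1..N. g i * QN4 a N c i) = (\<Sum>(i, k, j)\<in>events N. - (a i j k * c i * c j * g i))"
    unfolding events_def QN4_def by (simp add: sum_distrib_left sum.Sigma split_beta sum_negf mult_ac)
  show ?thesis
    by (simp only: QN_def distrib_left sum.distrib 1 2 3 4)
      (simp add: right_diff_distrib distrib_left sum.distrib sum_subtractf sum_negf split_beta)
qed

section \<open>Nonnegativity of the truncated solutions\<close>

lemma sum_ge_neg_bound:
  fixes f :: "'a \<Rightarrow> real"
  assumes "\<And>x. x \<in> S \<Longrightarrow> - X \<le> f x" "card S \<le> n" "0 \<le> X"
  shows "- (real n * X) \<le> (\<Sum>x\<in>S. f x)"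
proof -
  have "- (real n * X) \<le> real (card S) * (- X)"
    using assms by (simp add: mult_right_mono)
  also have "\<dots> \<le> (\<Sum>x\<in>S. f x)"
    using assms by (intro sum_bounded_below) auto
  finally show ?thesis .
qed

lemma truncated_solutionD:
  assumes "truncated_solution a N cin u"
  shows "i \<le> N \<Longrightarrow> u 0 i = cin i"
    and "0 \<le> t \<Longrightarrow> ((\<lambda>s. u s 0) has_real_derivative 0) (at t within {0..})"
    and "0 \<le> t \<Longrightarrow> 1 \<le> i \<Longrightarrow> i \<le> N \<Longrightarrow>
      ((\<lambda>s. u s i) has_real_derivative QN a N (u t) i) (at t within {0..})"
  using assms by (auto simp: truncated_solution_def QN_def)

text \<open>Each summand is at least \<open>- A * B * n\<close>, where \<open>n\<close> is the total
  negative part, and each of the four double sums has at most \<open>(N + 1)^2\<close>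
  summands.\<close>

lemma QN_quasi_positive:
  assumes a: "\<And>p q k. 1 \<le> k \<Longrightarrow> k \<le> p \<Longrightarrow> 0 \<le> a p q k"
    and A: "\<And>p q k. p \<le> N \<Longrightarrow> q \<le> N \<Longrightarrow> k \<le> N \<Longrightarrow> a p q k \<le> A"
    and B: "\<And>j. j \<le> N \<Longrightarrow> \<bar>c j\<bar> \<le> B"
    and i: "1 \<le> i" "i \<le> N" "c i < 0"
  shows "- (4 * (real (N + 1))\<^sup>2 * A * B) * (\<Sum>j\<in>{0..N}. max 0 (- c j)) \<le> QN a N c i"
proof -
  define n where "n = (\<Sum>j\<in>{0..N}. max 0 (- c j))"
  define X where "X = A * (B * n)"
  have n: "max 0 (- c j) \<le> n" if "j \<le> N" for j
    unfolding n_def using that by (intro member_le_sum) auto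
  have "0 \<le> n"
    unfolding n_def by (intro sum_nonneg) auto
  moreover have "0 \<le> B"
    using B[of 0] by (metis abs_ge_zero order_trans zero_le)
  moreover have "0 \<le> A"
    using a[of 1 1 0] A[of 1 0 1] i by linarith
  ultimately have pos: "0 \<le> n" "0 \<le> A" "0 \<le> B" "0 \<le> X"
    unfolding X_def by auto
  \<comment> \<open>A product \<open>c p * c q\<close> is negative only if its factors have opposite
    signs; the negative factor is then at most \<open>n\<close> in modulus and the other at most
    \<open>B\<close>.\<close>
  have gain: "- X \<le> a p q k * c p * c q" if "1 \<le> k" "k \<le> p" "p \<le> N" "q \<le> N" for p q k
  proof -
    have "- (B * n) \<le> c p * c q"
    proof (cases "c p < 0 \<longleftrightarrow> c q < 0")
      case True
      then have "0 \<le> c p * c q"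
        by (cases "c p < 0") (auto intro: mult_nonpos_nonpos)
      then show ?thesis
        using pos by (smt (verit) mult_nonneg_nonneg)
    next
      case False
      have "\<bar>c p * c q\<bar> \<le> B * n"
      proof (cases "c p < 0")
        case True
        then have "\<bar>c p * c q\<bar> \<le> n * B"
          unfolding abs_mult using n[of p] B[of q] that pos by (intro mult_mono) auto
        then show ?thesis
          by (simp add: mult.commute)
      next
        case nonneg: False
        then show ?thesis
          unfolding abs_mult using n[of q] B[of p] that pos False by (intro mult_mono) auto
      qed
      then show ?thesis
        by linarith
    qed
    then have "a p q k * - (B * n) \<le> a p q k * (c p * c q)"
      using a that by (intro mult_left_mono) auto
    moreover have "a p q k * (B * n) \<le> X"
      unfolding X_def using A that pos by (intro mult_right_mono) auto
    ultimately show ?thesis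
      by (simp add: mult.assoc)
  qed
  \<comment> \<open>Since \<open>c i < 0\<close>, a loss term can be negative only if
    \<open>c j < 0\<close> too, and then \<open>\<bar>c i\<bar> <= n\<close>.\<close>
  have loss: "- X \<le> - (a p q k * (c j * c i))" if "1 \<le> k" "k \<le> p" "p \<le> N" "q \<le> N" "j \<le> N" for p q k j
  proof -
    have "c j * c i \<le> B * n"
    proof (cases "c j < 0")
      case True
      have "\<bar>c j * c i\<bar> \<le> B * n"
        unfolding abs_mult using B[of j] n[of i] i that pos by (intro mult_mono) auto
      then show ?thesis by linarith
    next
      case False
      then have "c j * c i \<le> 0"
        using i by (simp add: mult_le_0_iff)
      then show ?thesis
        using pos by (smt (verit) mult_nonneg_nonneg)
    qed
    then have "a p q k * (c j * c i) \<le> a p q k * (B * n)"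
      using a that by (intro mult_left_mono) auto
    also have "\<dots> \<le> X"
      unfolding X_def using A that pos by (intro mult_right_mono) auto
    finally show ?thesis
      by simp
  qed
  let ?n = "N + 1"
  have 1: "- (real ?n * (real ?n * X)) \<le> QN1 a N c i"
    unfolding QN1_def using i pos by (intro sum_ge_neg_bound gain) auto
  have 2: "- (real ?n * (real ?n * X)) \<le> QN2 a N c i"
    unfolding QN2_def sum_negf[symmetric] mult.assoc
    using i pos by (intro sum_ge_neg_bound loss) auto
  have 3: "- (real ?n * (real ?n * X)) \<le> QN3 a N c i"
    unfolding QN3_def using i pos by (intro sum_ge_neg_bound gain) auto
  have 4: "- (real ?n * (real ?n * X)) \<le> QN4 a N c i"
    unfolding QN4_def sum_negf[symmetric] mult.assoc
    using i pos by (intro sum_ge_neg_bound loss) auto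
  have "- (4 * (real ?n * (real ?n * X))) \<le> QN a N c i"
    using 1 2 3 4 unfolding QN_def by linarith
  moreover have "- (4 * (real ?n * (real ?n * X))) = - (4 * (real ?n)\<^sup>2 * A * B) * n"
    unfolding X_def by algebra
  ultimately show ?thesis
    unfolding n_def by simp
qed

text \<open>On the compact interval from 0 to \<open>T\<close> the solution is bounded by
  continuity, and only finitely many coefficients occur, so the quasi-positivity constant can be
  chosen uniformly in time.\<close>

lemma truncated_solution_nonneg:
  assumes a: "\<And>p q k. 1 \<le> k \<Longrightarrow> k \<le> p \<Longrightarrow> 0 \<le> a p q k"
    and sol: "truncated_solution a N cin u"
    and cin: "\<And>i. 0 \<le> cin i"
    and "0 \<le> T" "i \<le> N"
  shows "0 \<le> u T i"
proof -
  define d where "d t i = (if i = 0 then 0 else QN a N (u t) i)" for t i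
  have deriv: "((\<lambda>s. u s i) has_real_derivative d t i) (at t within {0..})"
    if "0 \<le> t" "i \<in> {0..N}" for t i
    using truncated_solutionD[OF sol] that by (auto simp: d_def)
  have u0: "u t 0 = cin 0" if "0 \<le> t" for t
  proof -
    have "u t 0 = u 0 0"
      by (rule has_field_derivative_zero_constant[of "{0..}" "\<lambda>s. u s 0", THEN exE])
        (use truncated_solutionD(2)[OF sol] that in auto)
    then show ?thesis
      using truncated_solutionD(1)[OF sol, of 0] by simp
  qed
  have "bdd_above ((\<lambda>(p, q, k). a p q k) ` ({..N} \<times> {..N} \<times> {..N}))"
    by (intro bdd_above_finite) auto
  then obtain A0 where A0: "\<And>p q k. p \<le> N \<Longrightarrow> q \<le> N \<Longrightarrow> k \<le> N \<Longrightarrow> a p q k \<le> A0"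
    by (fastforce simp: bdd_above_def)
  have "continuous_on {0..T} (\<lambda>t. \<Sum>i\<in>{0..N}. \<bar>u t i\<bar>)"
  proof (intro continuous_intros)
    fix i assume "i \<in> {0..N}"
    then show "continuous_on {0..T} (\<lambda>t. u t i)"
      by (intro DERIV_continuous_on[where D = "\<lambda>t. d t i"] DERIV_subset[OF deriv]) auto
  qed
  then have "bdd_above ((\<lambda>t. \<Sum>i\<in>{0..N}. \<bar>u t i\<bar>) ` {0..T})"
    by (intro bounded_imp_bdd_above compact_imp_bounded compact_continuous_image compact_Icc)
  then obtain B where B: "\<And>t. 0 \<le> t \<Longrightarrow> t \<le> T \<Longrightarrow> (\<Sum>i\<in>{0..N}. \<bar>u t i\<bar>) \<le> B"
    by (fastforce simp: bdd_above_def)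
  \<comment> \<open>The maximum with 0 makes the constant passed to
    \<open>quasi_positive_nonneg\<close> nonnegative.\<close>
  define A where "A = max 0 A0"
  have "0 \<le> B"
    using order_trans[OF sum_nonneg B[of 0]] \<open>0 \<le> T\<close> by simp
  show ?thesis
  proof (rule quasi_positive_nonneg[where S = "{0..N}" and d = d and u = u])
    fix t i assume t: "0 \<le> t" "t \<le> T" and i: "i \<in> {0..N}" "u t i < 0"
    have "i \<noteq> 0"
      using u0[OF t(1)] cin[of 0] i by (metis not_less)
    moreover have "\<bar>u t j\<bar> \<le> B" if "j \<le> N" for j
      using member_le_sum[of j "{0..N}" "\<lambda>j. \<bar>u t j\<bar>"] B[OF t] that by simp
    ultimately have "- (4 * (real (N + 1))\<^sup>2 * A * B) * (\<Sum>j\<in>{0..N}. max 0 (- u t j)) \<le> QN a N (u t) i"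
      using a A0 i by (intro QN_quasi_positive) (auto simp: A_def intro: order_trans[OF A0])
    then show "- (4 * (real (N + 1))\<^sup>2 * A * B) * (\<Sum>j\<in>{0..N}. max 0 (- u t j)) \<le> d t i"
      using \<open>i \<noteq> 0\<close> by (simp add: d_def)
  next
    show "0 \<le> u 0 i" if "i \<in> {0..N}" for i
      using truncated_solutionD(1)[OF sol, of i] cin that by simp
  qed (use assms deriv \<open>0 \<le> B\<close> in \<open>auto simp: A_def\<close>)
qed

section \<open>Conservation of mass and growth of the test moments\<close>

lemma truncated_solution_weighted_sum_deriv:
  assumes "truncated_solution a N cin u" "0 \<le> t"
  shows "((\<lambda>s. \<Sum>i=1..N. g i * u s i) has_real_derivative (\<Sum>i=1..N. g i * QN a N (u t) i))
    (at t within {0..})"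
  using truncated_solutionD(3)[OF assms] by (intro DERIV_sum DERIV_cmult) auto

text \<open>For the weight \<open>g i = i\<close> every reaction contributes
  \<open>(i - k) - i + (j + k) - j = 0\<close> to the weak form.\<close>

lemma truncated_solution_mass:
  assumes sol: "truncated_solution a N cin u" and "0 \<le> t"
  shows "(\<Sum>i=1..N. real i * u t i) = (\<Sum>i=1..N. real i * cin i)"
proof -
  have "(\<Sum>i=1..N. real i * QN a N c i) = 0" for c
    by (subst QN_weak_form) (auto simp: events_def of_nat_diff intro!: sum.neutral)
  with truncated_solution_weighted_sum_deriv[OF sol, of _ real]
  have "((\<lambda>s. \<Sum>i=1..N. real i * u s i) has_real_derivative 0) (at s within {0..})" if "0 \<le> s" for s
    using that by simp
  then have "\<exists>K. \<forall>s\<in>{0..}. (\<Sum>i=1..N. real i * u s i) = K"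
    by (intro has_field_derivative_zero_constant) auto
  then have "(\<Sum>i=1..N. real i * u t i) = (\<Sum>i=1..N. real i * u 0 i)"
    using \<open>0 \<le> t\<close> by fastforce
  also have "\<dots> = (\<Sum>i=1..N. real i * cin i)"
    using truncated_solutionD(1)[OF sol] by simp
  finally show ?thesis .
qed

text \<open>Superadditivity bounds the donor's change by \<open>- h k\<close>, so a reaction
  contributes at most the defect \<open>h (j + k) - h j - h k\<close>. The defect bound absorbs
  \<open>j + k\<close>, and summing the remaining weight over \<open>k\<close> costs
  \<open>Qc * real i\<close>.\<close>

lemma QN_test_fun_le:
  fixes q :: "nat \<Rightarrow> nat \<Rightarrow> real"
  assumes a: "\<And>i j k. 1 \<le> k \<Longrightarrow> k \<le> i \<Longrightarrow> 0 \<le> a i j k"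
    and C: "0 \<le> C"
    and q: "\<And>i k. 1 \<le> k \<Longrightarrow> k \<le> i \<Longrightarrow> 0 \<le> q i k"
    and Qc: "\<And>i. 1 \<le> i \<Longrightarrow> (\<Sum>k=1..i. real k * real (i - k + 1) * q i k) \<le> Qc * real i"
    and growth: "\<And>i j k. 1 \<le> k \<Longrightarrow> k \<le> i \<Longrightarrow> 1 \<le> j \<Longrightarrow>
      a i j k \<le> C * real (i - k + 1) * real (j + k) * q i k"
    and c: "\<And>i. i \<le> N \<Longrightarrow> 0 \<le> c i"
    and m: "0 < m"
  shows "(\<Sum>i=1..N. test_fun m (real i) * QN a N c i)
    \<le> 4 * C * Qc * (\<Sum>i=1..N. real i * c i) * (\<Sum>i=1..N. test_fun m (real i) * c i)"
proof -
  define h where "h i = test_fun m (real i)" for i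
  \<comment> \<open>The quotient \<open>h i / real i\<close> comes from
    \<open>h k <= k * (h i / i)\<close>; its denominator cancels later against
    \<open>Qc * real i\<close>.\<close>
  define X where "X i j = 2 * C * c i * c j * (h j + real j * (h i / real i))" for i j
  define w where "w i k = real k * real (i - k + 1) * q i k" for i k
  have h0: "h 0 = 0" and h_nonneg: "0 \<le> h i" for i
    using m by (auto simp: h_def test_fun_nonneg)
  have X_nonneg: "0 \<le> X i j" if "i \<le> N" "j \<le> N" for i j
    unfolding X_def using that C c h_nonneg by (intro mult_nonneg_nonneg add_nonneg_nonneg) auto
  have w_nonneg: "0 \<le> w i k" if "1 \<le> k" "k \<le> i" for i k
    unfolding w_def using that q by simp
  have event: "a i j k * c i * c j * (h (i - k) - h i + h (j + k) - h j) \<le> w i k * X i j"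
    if k: "1 \<le> k" "k \<le> i" and ij: "i \<le> N" "j \<le> N" for i j k
  proof -
    have "h (i - k) + h k \<le> h i"
      using test_fun_superadditive[of m "real (i - k)" "real k"] m k
      by (simp add: h_def flip: of_nat_add)
    then have "a i j k * (h (i - k) - h i + h (j + k) - h j) \<le> a i j k * (h (j + k) - h j - h k)"
      using a[OF k] by (intro mult_left_mono) auto
    \<comment> \<open>The growth condition says nothing about \<open>j = 0\<close>, but there the
      defect \<open>h k - h 0 - h k\<close> vanishes.\<close>
    also have "\<dots> \<le> 2 * C * w i k * (h j + real j * (h i / real i))"
    proof (cases "j = 0")
      case True
      then show ?thesis
        using h0 by simp
    next
      case False
      define D where "D = h (j + k) - h j - h k"
      have "0 \<le> D"
        using test_fun_superadditive[of m "real j" "real k"] m by (simp add: D_def h_def)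
      then have "a i j k * D \<le> C * real (i - k + 1) * real (j + k) * q i k * D"
        using growth[OF k, of j] False by (intro mult_right_mono) auto
      also have "\<dots> = C * real (i - k + 1) * q i k * (real (j + k) * D)"
        by (simp only: mult_ac)
      also have "\<dots> \<le> C * real (i - k + 1) * q i k * (2 * (real k * h j + real j * h k))"
        using test_fun_defect_le[of m "real j" "real k"] m C q[OF k]
        by (intro mult_left_mono) (auto simp: D_def h_def)
      also have "\<dots> \<le> C * real (i - k + 1) * q i k * (2 * (real k * h j + real j * (real k * (h i / real i))))"
      proof -
        have "real i * h k \<le> real k * h i"
          unfolding h_def using m k by (intro test_fun_star_shaped) auto
        then have "h k \<le> real k * (h i / real i)"
          using k by (simp add: field_simps)
        then show ?thesis
          using C q[OF k] by (intro mult_left_mono add_left_mono) auto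
      qed
      also have "\<dots> = 2 * C * w i k * (h j + real j * (h i / real i))"
        by (simp add: w_def algebra_simps)
      finally show ?thesis
        by (simp add: D_def)
    qed
    finally have "(c i * c j) * (a i j k * (h (i - k) - h i + h (j + k) - h j))
        \<le> (c i * c j) * (2 * C * w i k * (h j + real j * (h i / real i)))"
      using c ij by (intro mult_left_mono) auto
    then show ?thesis
      by (simp only: X_def mult_ac)
  qed
  have "(\<Sum>i=1..N. h i * QN a N c i) =
      (\<Sum>(i, k, j)\<in>events N. a i j k * c i * c j * (h (i - k) - h i + h (j + k) - h j))"
    using h0 by (rule QN_weak_form)
  also have "\<dots> \<le> (\<Sum>(i, k, j)\<in>events N. w i k * X i j)"
    by (intro sum_mono) (auto simp: events_def intro!: event)
  also have "\<dots> = (\<Sum>i=1..N. \<Sum>k=1..i. \<Sum>j=0..N - k. w i k * X i j)"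
    by (simp add: events_def sum.Sigma split_beta)
  \<comment> \<open>Enlarging the range of \<open>j\<close> decouples it from \<open>k\<close>, so
    the sum over \<open>k\<close> only sees \<open>w i k\<close>.\<close>
  also have "\<dots> \<le> (\<Sum>i=1..N. \<Sum>k=1..i. \<Sum>j=0..N. w i k * X i j)"
    using X_nonneg w_nonneg by (intro sum_mono sum_mono2 mult_nonneg_nonneg) auto
  also have "\<dots> = (\<Sum>i=1..N. (\<Sum>k=1..i. w i k) * (\<Sum>j=0..N. X i j))"
    by (simp add: sum_product)
  also have "\<dots> \<le> (\<Sum>i=1..N. (Qc * real i) * (\<Sum>j=0..N. X i j))"
    using X_nonneg Qc by (intro sum_mono mult_right_mono sum_nonneg) (auto simp: w_def)
  also have "\<dots> = (\<Sum>i=1..N. \<Sum>j=0..N.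
      2 * C * Qc * ((real i * c i) * (h j * c j) + (h i * c i) * (real j * c j)))"
    unfolding sum_distrib_left by (intro sum.cong) (auto simp: X_def field_simps)
  also have "\<dots> = (\<Sum>i=1..N. \<Sum>j=1..N.
      2 * C * Qc * ((real i * c i) * (h j * c j) + (h i * c i) * (real j * c j)))"
    using h0 by (intro sum.cong sum.mono_neutral_right) (auto simp: Suc_le_eq)
  \<comment> \<open>Both products sum to the same product of moments, which doubles the factor
    2.\<close>
  also have "\<dots> = 4 * C * Qc * (\<Sum>i=1..N. real i * c i) * (\<Sum>i=1..N. h i * c i)"
    by (simp only: sum_distrib_left[symmetric] sum_distrib_right[symmetric] sum.distrib) algebra
  finally show ?thesis
    by (simp add: h_def)
qed

section \<open>Passage to the limit in the truncation\<close>

theorem theorem3p5: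
  fixes a :: "nat \<Rightarrow> nat \<Rightarrow> nat \<Rightarrow> real"
    and C Qc :: real
    and q :: "nat \<Rightarrow> nat \<Rightarrow> real"
    and cin :: "nat \<Rightarrow> real"
    and c :: "real \<Rightarrow> nat \<Rightarrow> real"
  assumes "rate_coefficients a"
    and "C \<ge> 1" and "Qc \<ge> 1"
    and "\<And>i k. 1 \<le> k \<Longrightarrow> k \<le> i \<Longrightarrow> 0 \<le> q i k"
    and "\<And>i. 1 \<le> i \<Longrightarrow> (\<Sum>k=1..i. real k * real (i - k + 1) * q i k) \<le> Qc * real i"
    and "\<And>i j k. 1 \<le> k \<Longrightarrow> k \<le> i \<Longrightarrow> 1 \<le> j \<Longrightarrow>
           a i j k \<le> C * real (i - k + 1) * real (j + k) * q i k"
    and "cin \<in> X01_pos"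
    and "admissible_solution a cin c"
  shows "\<forall>t\<ge>0. (\<Sum>i. real i * c t i) = (\<Sum>i. real i * cin i)"
proof (intro allI impI)
  fix t :: real assume t: "0 \<le> t"
  have a: "0 \<le> a i j k" if "1 \<le> k" "k \<le> i" for i j k
    using assms(1) that by (auto simp: rate_coefficients_def)
  have cin: "0 \<le> cin i" for i
    using assms(7) by (simp add: X01_pos_def)
  have "summable (\<lambda>i. (1 + real i) * \<bar>cin i\<bar>)"
    using assms(7) unfolding X01_pos_def X01_def by blast
  then have summ: "summable (\<lambda>i. real i * cin i)"
    by (rule summable_comparison_test'[where N = 0]) (auto simp: abs_mult intro!: mult_right_mono)
  obtain N u where N: "strict_mono N"
    and sol: "\<And>n. truncated_solution a (N n) cin (u n)"
    and lim: "\<And>i s. 0 \<le> s \<Longrightarrow> (\<lambda>n. u n s i) \<longlonglongrightarrow> c s i"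
    using assms(8) unfolding admissible_solution_def by blast
  define M where "M = (\<Sum>i. real i * cin i)"
  \<comment> \<open>The parameter \<open>Suc r\<close> makes \<open>test_fun_ge_half\<close> valid
    exactly for the sizes beyond the cutoff \<open>r\<close>, and it is positive even for
    \<open>r = 0\<close>.\<close>
  define \<epsilon> where "\<epsilon> r = (\<Sum>i. test_fun (real (Suc r)) (real i) * cin i)" for r
  define K where "K = 4 * C * Qc * M"
  have u: "0 \<le> u n s i" if "0 \<le> s" "i \<le> N n" for n s i
    using truncated_solution_nonneg[OF _ sol] a cin that by blast
  have N_large: "\<forall>\<^sub>F n in sequentially. r \<le> N n" for r
    using filterlim_subseq[OF N] by (simp add: filterlim_at_top)
  have partial_le: "(\<Sum>i=1..n. real i * cin i) \<le> M" for n
    unfolding M_def using summ cin by (intro sum_le_suminf) auto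
  have summ_h: "summable (\<lambda>i. test_fun (real (Suc r)) (real i) * cin i)" for r
    using summ
    by (rule summable_comparison_test'[where N = 0])
      (auto simp: abs_mult cin test_fun_nonneg intro!: mult_right_mono test_fun_le)
  have test_bound: "(\<Sum>i=1..N n. test_fun (real (Suc r)) (real i) * u n t i) \<le> exp (K * t) * \<epsilon> r" for n r
  proof -
    let ?h = "\<lambda>i. test_fun (real (Suc r)) (real i)"
    have "(\<Sum>i=1..N n. ?h i * u n t i) \<le> exp (K * t) * (\<Sum>i=1..N n. ?h i * u n 0 i)"
    proof (rule gronwall)
      fix s :: real assume s: "0 \<le> s"
      show "((\<lambda>s. \<Sum>i=1..N n. ?h i * u n s i) has_real_derivative
          (\<Sum>i=1..N n. ?h i * QN a (N n) (u n s) i)) (at s within {0..})"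
        by (rule truncated_solution_weighted_sum_deriv[OF sol s])
      have "(\<Sum>i=1..N n. ?h i * QN a (N n) (u n s) i)
          \<le> 4 * C * Qc * (\<Sum>i=1..N n. real i * u n s i) * (\<Sum>i=1..N n. ?h i * u n s i)"
        using assms(2) u[OF s] by (intro QN_test_fun_le[where q = q] a assms(4-6)) auto
      \<comment> \<open>Conservation of mass turns the quadratic inequality into a linear one, whose
        rate is then bounded by \<open>K\<close> for all truncations.\<close>
      also have "\<dots> = 4 * C * Qc * (\<Sum>i=1..N n. real i * cin i) * (\<Sum>i=1..N n. ?h i * u n s i)"
        by (simp only: truncated_solution_mass[OF sol s])
      also have "\<dots> \<le> K * (\<Sum>i=1..N n. ?h i * u n s i)"
        unfolding K_def using assms(2,3) u[OF s] partial_le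
        by (intro mult_right_mono mult_left_mono sum_nonneg mult_nonneg_nonneg test_fun_nonneg) auto
      finally show "(\<Sum>i=1..N n. ?h i * QN a (N n) (u n s) i) \<le> K * (\<Sum>i=1..N n. ?h i * u n s i)" .
    qed fact
    also have "(\<Sum>i=1..N n. ?h i * u n 0 i) = (\<Sum>i=1..N n. ?h i * cin i)"
      using truncated_solutionD(1)[OF sol] by simp
    also have "\<dots> \<le> \<epsilon> r"
      unfolding \<epsilon>_def using cin by (intro sum_le_suminf summ_h) (auto simp: test_fun_nonneg)
    finally show ?thesis
      by simp
  qed
  \<comment> \<open>Beyond \<open>r\<close> each weight \<open>real i\<close> is at most twice the
    test function, so the mass there is at most twice the test moment.\<close>
  have tail: "(\<Sum>i=1..N n. real i * cin i) - 2 * exp (K * t) * \<epsilon> r \<le> (\<Sum>i\<le>r. real i * u n t i)"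
    if "r \<le> N n" for n r
  proof -
    have "(\<Sum>i=1..N n. real i * cin i) = (\<Sum>i=1..N n. real i * u n t i)"
      using truncated_solution_mass[OF sol t] by simp
    also have "\<dots> = (\<Sum>i=1..r. real i * u n t i) + (\<Sum>i=Suc r..N n. real i * u n t i)"
      using that by (subst sum.union_disjoint[symmetric]) (auto intro!: sum.cong)
    also have "(\<Sum>i=1..r. real i * u n t i) = (\<Sum>i\<le>r. real i * u n t i)"
      by (intro sum.mono_neutral_left) (auto simp: Suc_le_eq)
    also have "(\<Sum>i=Suc r..N n. real i * u n t i)
        \<le> (\<Sum>i=Suc r..N n. 2 * (test_fun (real (Suc r)) (real i) * u n t i))"
    proof (rule sum_mono)
      fix i assume i: "i \<in> {Suc r..N n}"
      then have "real i / 2 * u n t i \<le> test_fun (real (Suc r)) (real i) * u n t i"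
        using u[OF t] by (intro mult_right_mono test_fun_ge_half) auto
      then show "real i * u n t i \<le> 2 * (test_fun (real (Suc r)) (real i) * u n t i)"
        by simp
    qed
    also have "\<dots> \<le> (\<Sum>i=1..N n. 2 * (test_fun (real (Suc r)) (real i) * u n t i))"
      using u[OF t] by (intro sum_mono2) (auto simp: test_fun_nonneg)
    also have "\<dots> \<le> 2 * (exp (K * t) * \<epsilon> r)"
      unfolding sum_distrib_left[symmetric] by (intro mult_left_mono test_bound) auto
    finally show ?thesis
      by simp
  qed
  have head: "(\<Sum>i\<le>r. real i * u n t i) \<le> M" if "r \<le> N n" for n r
  proof -
    have "(\<Sum>i\<le>r. real i * u n t i) = (\<Sum>i=1..r. real i * u n t i)"
      by (intro sum.mono_neutral_right) (auto simp: Suc_le_eq)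
    also have "\<dots> \<le> (\<Sum>i=1..N n. real i * u n t i)"
      using that u[OF t] by (intro sum_mono2) auto
    finally show ?thesis
      using truncated_solution_mass[OF sol t, of n] partial_le[of "N n"] by simp
  qed
  have lim_head: "(\<lambda>n. \<Sum>i\<le>r. real i * u n t i) \<longlonglongrightarrow> (\<Sum>i\<le>r. real i * c t i)" for r
    by (intro tendsto_intros lim t)
  have "(\<lambda>n. \<Sum>i\<in>{1..n}. real i * cin i) \<longlonglongrightarrow> M"
  proof -
    have "(\<Sum>i\<in>{1..n}. real i * cin i) = (\<Sum>i\<le>n. real i * cin i)" for n
      by (intro sum.mono_neutral_left) (auto simp: Suc_le_eq)
    then show ?thesis
      unfolding M_def using summable_LIMSEQ'[OF summ] by simp
  qed
  then have lim_mass: "(\<lambda>n. \<Sum>i=1..N n. real i * cin i) \<longlonglongrightarrow> M"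
    using LIMSEQ_subseq_LIMSEQ[OF _ N] by (fastforce simp: o_def)
  \<comment> \<open>The limit in \<open>n\<close> is taken at fixed \<open>r\<close>, where only
    finitely many components matter and pointwise convergence suffices; \<open>r\<close> tends to
    infinity afterwards.\<close>
  have upper: "(\<Sum>i\<le>r. real i * c t i) \<le> M" for r
    using lim_head eventually_mono[OF N_large[of r] head] by (rule tendsto_upperbound) simp_all
  have lower: "M - 2 * exp (K * t) * \<epsilon> r \<le> (\<Sum>i\<le>r. real i * c t i)" for r
  proof (rule tendsto_le[OF sequentially_bot lim_head])
    show "(\<lambda>n. (\<Sum>i=1..N n. real i * cin i) - 2 * exp (K * t) * \<epsilon> r) \<longlonglongrightarrow> M - 2 * exp (K * t) * \<epsilon> r"
      by (intro tendsto_intros lim_mass)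
    show "\<forall>\<^sub>F n in sequentially. (\<Sum>i=1..N n. real i * cin i) - 2 * exp (K * t) * \<epsilon> r
        \<le> (\<Sum>i\<le>r. real i * u n t i)"
      by (rule eventually_mono[OF N_large[of r] tail])
  qed
  have "(\<lambda>r. M - 2 * exp (K * t) * \<epsilon> r) \<longlonglongrightarrow> M - 2 * exp (K * t) * 0"
    unfolding \<epsilon>_def using test_fun_sum_tendsto_0[OF summ cin] by (intro tendsto_intros)
  then have "(\<lambda>r. M - 2 * exp (K * t) * \<epsilon> r) \<longlonglongrightarrow> M"
    by simp
  then have "(\<lambda>r. \<Sum>i\<le>r. real i * c t i) \<longlonglongrightarrow> M"
    by (rule tendsto_sandwich[rotated 2, OF _ tendsto_const]) (simp_all add: lower upper)
  \<comment> \<open>Going through \<open>sums\<close> establishes convergence together with the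
    value, so the series in the conclusion is a genuine sum.\<close>
  then have "(\<lambda>i. real i * c t i) sums M"
    by (simp add: sums_def_le)
  then show "(\<Sum>i. real i * c t i) = (\<Sum>i. real i * cin i)"
    unfolding M_def by (rule sums_unique[symmetric])
qed

end
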